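(* The iBlackhole-DC algorithm is complete and correct: for every finite directed graph $G=(V,E)$ and every integer $n\ge 1$, the output $\mathit{Blackhole}$ of iBlackhole-DC$(G,n)$ is exactly the set of all $i$-node blackholes of $G$ with $1\le i\le n$. That is, every $i$-node blackhole with $1\le i\le n$ is in the output (completeness), and every element of the output is an $i$-node blackhole of $G$ for some $1\le i\le n$ (correctness).
   Context: Directed graphs $G=(V,E)$ have no self-loops and no more than one edge between any pair of nodes. An edge $(x,y)$ is directed from $x$ to $y$. For $B\subseteq V$, $d_{out}(B)$ is the number of edges $(x,y)\in E$ with $x\in B$, $y\in V\setminus B$; for a node $v$, $d_{out}(v)$ is its out-degree. A set $B\subseteq V$ is a blackhole if (1) whenever $|B|\ge 2$, the subgraph $G(B)$ induced by $B$ is weakly connected, and (2) $d_{out}(B)=0$. It is an $i$-node blackhole if moreover $|B|=i$. A single-node induced subgraph counts as weakly connected. A directed path from $v_0$ to $v_k$ is a sequence of pairwise distinct nodes $v_0,\dots,v_k$ with $(v_{j-1},v_j)\in E$ for all $1\le j\le k$. If there is a directed path from $u$ to $v$, then $u$ is a predecessor of $v$; if $(u,v)\in E$, then $v$ is a direct successor of $u$. The closure of $v$ is $v^+=\{s : \text{there is a directed path from } v \text{ to } s\}\cup\{v\}$ (computed in $G$). Algorithm iBlackhole-DC$(G,n)$. Set $\mathit{Blackhole}\leftarrow\emptyset$ and $C_0\leftarrow\emptyset$. For $i=1,\dots,n$ do: (a) $P_i\leftarrow\{v\in V: d_{out}(v)<i\}$. (b) For each $v$ in $P_i$: if $v\notin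 C_{i-1}$ and at least one direct successor of $v$ is not in (the current) $P_i$, remove $v$ and all its predecessors from $P_i$. (c) $C_i\leftarrow P_i$. (d) For each $v$ in $C_i$: if $|v^+|>i$, remove $v$ and all its predecessors from $C_i$; if $|v^+|=i$, add the set $v^+$ as an element of $\mathit{Blackhole}$ and remove $v$ and all its predecessors from $C_i$. (e) $F_i\leftarrow C_i$. (f) For each weakly connected component of the induced subgraph $G(F_i)$, with node set $W$, and for each subset $B\subseteq W$ with $|B|=i$: if $G(B)$ is weakly connected and $d_{out}(B)=0$ (computed in $G$), add $B$ as an element of $\mathit{Blackhole}$. Return $\mathit{Blackhole}$. In each "for each" loop in (b) and (d) the nodes are processed one after another in an arbitrary order, and nodes already removed from the list are not processed. *)

theory Defs
  imports "Graph_Theory.Digraph_Component"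
begin

text \<open>
  The graphs are those of the locale \<^locale>\<open>digraph\<close>: finite, without loops, and with at most
  one arc from \<open>x\<close> to \<open>y\<close> for each ordered pair \<open>(x, y)\<close>; arcs \<open>(x, y)\<close> and \<open>(y, x)\<close> may coexist.
  Weak connectivity is \<^const>\<open>connected\<close>, which holds for single-node graphs and fails for the
  empty graph.
\<close>

definition predecessor :: "('a, 'b) pre_digraph \<Rightarrow> 'a \<Rightarrow> 'a \<Rightarrow> bool" where
  "predecessor G u v \<longleftrightarrow> (\<exists>p. pre_digraph.apath G u p v)"

definition closure_of :: "('a, 'b) pre_digraph \<Rightarrow> 'a \<Rightarrow> 'a set" where
  "closure_of G v = {s. predecessor G v s} \<union> {v}"

definition d_out :: "('a, 'b) pre_digraph \<Rightarrow> 'a set \<Rightarrow> nat" where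
  "d_out G B = card {e \<in> arcs G. tail G e \<in> B \<and> head G e \<in> verts G - B}"

definition blackhole :: "('a, 'b) pre_digraph \<Rightarrow> 'a set \<Rightarrow> bool" where
  "blackhole G B \<longleftrightarrow>
     B \<subseteq> verts G \<and> (card B \<ge> 2 \<longrightarrow> connected (G \<restriction> B)) \<and> d_out G B = 0"

definition node_blackhole :: "('a, 'b) pre_digraph \<Rightarrow> nat \<Rightarrow> 'a set \<Rightarrow> bool" where
  "node_blackhole G i B \<longleftrightarrow> blackhole G B \<and> card B = i"

definition weak_components :: "('a, 'b) pre_digraph \<Rightarrow> 'a set set" where
  "weak_components H = {verts K | K. pre_digraph.max_subgraph H connected K}"

definition remove_preds :: "('a, 'b) pre_digraph \<Rightarrow> 'a \<Rightarrow> 'a set \<Rightarrow> 'a set" where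
  "remove_preds G v A = A - ({v} \<union> {u. predecessor G u v})"

text \<open>
  The loops (b) and (d) are folds over an enumeration of the initial list; a node that is no
  longer in the current list when its turn comes is skipped. Arbitrary processing order means
  that every enumeration is allowed, independently in each loop and each iteration.
\<close>

definition potential_step ::
    "('a, 'b) pre_digraph \<Rightarrow> 'a set \<Rightarrow> 'a \<Rightarrow> 'a set \<Rightarrow> 'a set" where
  "potential_step G C v P =
     (if v \<in> P \<and> v \<notin> C \<and> (\<exists>s. v \<rightarrow>\<^bsub>G\<^esub> s \<and> s \<notin> P) then remove_preds G v P else P)"

definition candidate_step ::
    "('a, 'b) pre_digraph \<Rightarrow> nat \<Rightarrow> 'a \<Rightarrow> 'a set \<times> 'a set set \<Rightarrow> 'a set \<times> 'a set set" where
  "candidate_step G i v = (\<lambda>(C, Bh).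
     if v \<notin> C then (C, Bh)
     else if card (closure_of G v) > i then (remove_preds G v C, Bh)
     else if card (closure_of G v) = i then (remove_preds G v C, insert (closure_of G v) Bh)
     else (C, Bh))"

definition potential_loop ::
    "('a, 'b) pre_digraph \<Rightarrow> 'a set \<Rightarrow> 'a set \<Rightarrow> 'a set \<Rightarrow> bool" where
  "potential_loop G C P P' \<longleftrightarrow>
     (\<exists>vs. distinct vs \<and> set vs = P \<and> P' = fold (potential_step G C) vs P)"

definition candidate_loop ::
    "('a, 'b) pre_digraph \<Rightarrow> nat \<Rightarrow> 'a set \<Rightarrow> 'a set set \<Rightarrow> 'a set \<Rightarrow> 'a set set \<Rightarrow> bool" where
  "candidate_loop G i C Bh C' Bh' \<longleftrightarrow>
     (\<exists>vs. distinct vs \<and> set vs = C \<and> (C', Bh') = fold (candidate_step G i) vs (C, Bh))"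

definition final_blackholes :: "('a, 'b) pre_digraph \<Rightarrow> nat \<Rightarrow> 'a set \<Rightarrow> 'a set set" where
  "final_blackholes G i F =
     (\<Union>W \<in> weak_components (G \<restriction> F).
        {B. B \<subseteq> W \<and> card B = i \<and> connected (G \<restriction> B) \<and> d_out G B = 0})"

text \<open>
  \<open>dc_run G i Bh C\<close>: some execution of the first \<open>i\<close> iterations ends with \<open>Blackhole = Bh\<close> and
  with \<open>C\<close> the value of \<open>C\<^sub>i\<close> after the removals in (d), which is also \<open>F\<^sub>i\<close>.
\<close>

inductive dc_run :: "('a, 'b) pre_digraph \<Rightarrow> nat \<Rightarrow> 'a set set \<Rightarrow> 'a set \<Rightarrow> bool"
  for G :: "('a, 'b) pre_digraph" where
  init: "dc_run G 0 {} {}"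
| iter: "dc_run G (Suc i) (Bh' \<union> final_blackholes G (Suc i) C') C'"
  if "dc_run G i Bh C"
    and "potential_loop G C {v \<in> verts G. out_degree G v < Suc i} P"
    and "candidate_loop G (Suc i) P Bh C' Bh'"

text \<open>\<open>iBlackhole_DC G n Bh\<close>: \<open>Bh\<close> is a possible output of the algorithm on input \<open>G\<close>, \<open>n\<close>.\<close>

definition iBlackhole_DC :: "('a, 'b) pre_digraph \<Rightarrow> nat \<Rightarrow> 'a set set \<Rightarrow> bool" where
  "iBlackhole_DC G n Bh \<longleftrightarrow> (\<exists>C. dc_run G n Bh C)"

end

theory Submission
  imports Defs
begin

text \<open>
  A blackhole \<open>B\<close> contains every direct successor of each of its nodes, so no predecessor of a
  node outside \<open>B\<close> lies in \<open>B\<close>. If \<open>B\<close> has \<open>i\<close> nodes, all of them have out-degree less than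
  \<open>i\<close>; loop (b) never removes a node of \<open>B\<close>, since it would first have to process a node of \<open>B\<close>
  with a successor outside the list; and loop (d) keeps \<open>B\<close> unless it processes some
  \<open>v \<in> B\<close> with \<open>|v\<^sup>+| \<ge> i\<close>, in which case \<open>v\<^sup>+ \<subseteq> B\<close> forces \<open>B = v\<^sup>+\<close> and \<open>B\<close> is output.
  If \<open>B\<close> survives, it lies in one weak component and is found by the search in (f). This holds
  whatever the value of \<open>C\<^sub>i\<^sub>-\<^sub>1\<close> is, so the iterations can be treated separately.
  Conversely, a closure is always a blackhole.
\<close>

text \<open>Finiteness bounds the number of vertices plus arcs, so some subgraph with
  \<open>P\<close> above \<open>S\<close> maximizes it. A larger subgraph with \<open>P\<close>
  would have the same counts, hence the same vertices and arcs.\<close>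

lemma (in fin_digraph) max_subgraph_exists:
  assumes "subgraph S G" "P S"
  shows "\<exists>K. max_subgraph P K \<and> subgraph S K"
proof -
  let ?Q = "\<lambda>K. subgraph K G \<and> P K \<and> subgraph S K"
  let ?f = "\<lambda>K. card (verts K) + card (arcs K)"
  have S: "?Q S"
    using assms by (auto simp: subgraph_def compatible_def)
  have "\<forall>K. ?Q K \<longrightarrow> ?f K < Suc (?f G)"
    by (auto simp: subgraph_def less_Suc_eq_le intro!: add_mono card_mono)
  with S obtain K where K: "?Q K" and max: "\<And>K'. ?Q K' \<Longrightarrow> ?f K' \<le> ?f K"
    using ex_has_greatest_nat[of ?Q S ?f "Suc (?f G)"] by auto
  have "\<not> (subgraph H G \<and> P H)" if "H \<noteq> K" "subgraph K H" for H
  proof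
    assume H: "subgraph H G \<and> P H"
    with that K have "?Q H" by (auto intro: subgraph_trans)
    with max have le: "?f H \<le> ?f K" by blast
    have fin: "finite (verts H)" "finite (arcs H)"
      using H by (auto simp: subgraph_def intro: finite_subset)
    have sub: "verts K \<subseteq> verts H" "arcs K \<subseteq> arcs H"
      using that by (auto simp: subgraph_def)
    then have "card (verts K) \<le> card (verts H)" "card (arcs K) \<le> card (arcs H)"
      using fin by (auto intro: card_mono)
    with le have "card (verts H) = card (verts K)" "card (arcs H) = card (arcs K)"
      by linarith+
    with sub fin have "verts K = verts H" "arcs K = arcs H"
      by (auto simp: card_subset_eq)
    \<comment> \<open>Equality of the records also needs equal \<open>tail\<close> and
      \<open>head\<close> maps, which compatibility provides.\<close>
    moreover have "tail K = tail H" "head K = head H"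
      using that by (auto simp: subgraph_def compatible_def)
    ultimately show False using \<open>H \<noteq> K\<close> by simp
  qed
  with K show ?thesis by (auto simp: max_subgraph_def)
qed

section \<open>Closures as sets of reachable nodes\<close>

context wf_digraph
begin

text \<open>Every walk shortens to one with distinct nodes, so later arguments can use the
  transitivity of reachability.\<close>

lemma predecessor_iff_reachable: "predecessor G u v \<longleftrightarrow> u \<rightarrow>\<^sup>* v"
  by (simp add: predecessor_def reachable_apath)

lemma closure_of_eq:
  assumes "v \<in> verts G"
  shows "closure_of G v = {s. v \<rightarrow>\<^sup>* s}"
  using assms by (auto simp: closure_of_def predecessor_iff_reachable)

text \<open>Directed paths from \<open>v\<close> stay inside the reachable set. After symmetrizing,
  any two nodes are joined by going back to \<open>v\<close> and out again.\<close>

lemma connected_induce_reachable: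
  assumes "v \<in> verts G"
  shows "connected (G \<restriction> {s. v \<rightarrow>\<^sup>* s})"
proof -
  let ?H = "G \<restriction> {s. v \<rightarrow>\<^sup>* s}"
  interpret H: wf_digraph ?H
    by (rule wellformed_induce_subgraph)
  interpret M: pair_wf_digraph "mk_symmetric ?H"
    by (rule H.wellformed_mk_symmetric)
  have to: "v \<rightarrow>\<^sup>*\<^bsub>mk_symmetric ?H\<^esub> s" if "v \<rightarrow>\<^sup>* s" for s
    using induce_reachable_preserves_paths[OF that] by (rule H.reachable_mk_symmetricI)
  have "u \<rightarrow>\<^sup>*\<^bsub>mk_symmetric ?H\<^esub> w" if "v \<rightarrow>\<^sup>* u" "v \<rightarrow>\<^sup>* w" for u w
    using to[OF that(1)] to[OF that(2)] symmetric_mk_symmetric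
    by (metis M.reachable_trans symmetric_reachable)
  then show ?thesis
    using assms by (auto simp: connected_def strongly_connected_def)
qed

end

section \<open>Blackholes as sets closed under successors\<close>

context fin_digraph
begin

lemma d_out_eq_0_iff:
  assumes "B \<subseteq> verts G"
  shows "d_out G B = 0 \<longleftrightarrow> (\<forall>u\<in>B. \<forall>w. u \<rightarrow> w \<longrightarrow> w \<in> B)"
proof -
  have "d_out G B = 0 \<longleftrightarrow> (\<forall>e\<in>arcs G. tail G e \<in> B \<longrightarrow> head G e \<in> B)"
    by (auto simp: d_out_def)
  then show ?thesis
    by (auto simp: arcs_ends_def arc_to_ends_def)
qed

lemma reachable_in_blackhole:
  assumes "blackhole G B" "u \<rightarrow>\<^sup>* w" "u \<in> B"
  shows "w \<in> B"
  using assms(2,3)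
proof (induct rule: reachable_induct)
  case base
  then show ?case by simp
next
  case (step x y)
  with assms(1) show ?case
    by (auto simp: blackhole_def d_out_eq_0_iff)
qed

lemma remove_preds_disjoint_blackhole:
  assumes "blackhole G B" "v \<notin> B" "B \<subseteq> A"
  shows "B \<subseteq> remove_preds G v A"
  using assms reachable_in_blackhole
  by (auto simp: remove_preds_def predecessor_iff_reachable)

lemma closure_of_subset_blackhole:
  assumes "blackhole G B" "v \<in> B"
  shows "closure_of G v \<subseteq> B"
  using assms reachable_in_blackhole
  by (auto simp: closure_of_def predecessor_iff_reachable)

lemma blackhole_closure_of:
  assumes "v \<in> verts G"
  shows "blackhole G (closure_of G v)"
proof -
  have sub: "{s. v \<rightarrow>\<^sup>* s} \<subseteq> verts G"
    using reachable_in_verts by blast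
  show ?thesis
    unfolding blackhole_def closure_of_eq[OF assms] d_out_eq_0_iff[OF sub]
    using sub connected_induce_reachable[OF assms] by (auto intro: reachable_adj_trans)
qed

text \<open>This bridges a difference in the definitions: \<open>blackhole\<close> demands
  connectivity only from two nodes on, while the search in (f) always tests it.\<close>

lemma connected_blackhole:
  assumes "blackhole G B" "B \<noteq> {}"
  shows "connected (G \<restriction> B)"
proof (cases "card B \<ge> 2")
  case True
  with assms show ?thesis by (simp add: blackhole_def)
next
  case False
  have "finite B"
    using assms by (auto simp: blackhole_def intro: finite_subset)
  with False assms have "card B = 1"
    by (simp add: card_gt_0_iff le_antisym not_less_eq_eq numeral_2_eq_2 Suc_leI)
  then obtain x where "B = {x}" by (auto simp: card_1_singleton_iff)
  then show ?thesis by (simp add: connected_conv rtrancl_on_refl)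
qed

lemma mem_final_blackholes_iff:
  assumes "F \<subseteq> verts G" "i \<ge> 1"
  shows "B \<in> final_blackholes G i F \<longleftrightarrow> node_blackhole G i B \<and> B \<subseteq> F"
proof
  assume "B \<in> final_blackholes G i F"
  then obtain K where K: "pre_digraph.max_subgraph (G \<restriction> F) connected K" and B: "B \<subseteq> verts K"
    "card B = i" "connected (G \<restriction> B)" "d_out G B = 0"
    by (auto simp: final_blackholes_def weak_components_def)
  from K have "verts K \<subseteq> F"
    by (auto simp: pre_digraph.max_subgraph_def subgraph_def)
  with B assms show "node_blackhole G i B \<and> B \<subseteq> F"
    by (auto simp: node_blackhole_def blackhole_def)
next
  assume B: "node_blackhole G i B \<and> B \<subseteq> F"
  \<comment> \<open>Here \<open>i \<ge> 1\<close> makes \<open>B\<close> nonempty;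
    \<open>connected\<close> fails for the empty graph.\<close>
  with assms have con: "connected (G \<restriction> B)"
    by (intro connected_blackhole) (auto simp: node_blackhole_def)
  have "subgraph (G \<restriction> F) G"
    using assms by (simp add: subgraph_induce_subgraphI)
  then interpret F: fin_digraph "G \<restriction> F"
    by (rule fin_digraph_subgraph)
  have "wf_digraph (G \<restriction> B)"
    by (rule wellformed_induce_subgraph)
  with B have "subgraph (G \<restriction> B) (G \<restriction> F)"
    by (auto simp: subgraph_def compatible_def F.wf_digraph_axioms)
  \<comment> \<open>The vertex set of \<open>K\<close> is the weak component \<open>W\<close> in
    which the search finds \<open>B\<close>.\<close>
  with con obtain K where "F.max_subgraph connected K" "subgraph (G \<restriction> B) K"
    using F.max_subgraph_exists[of "G \<restriction> B" connected] by blast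
  with B con show "B \<in> final_blackholes G i F"
    by (auto simp: final_blackholes_def weak_components_def node_blackhole_def blackhole_def
        subgraph_def)
qed

section \<open>Invariants of the loops (b) and (d)\<close>

lemma fold_potential_step_subset: "fold (potential_step G C) vs P \<subseteq> P"
proof (induct vs arbitrary: P)
  case (Cons v vs)
  have "potential_step G C v P \<subseteq> P"
    by (auto simp: potential_step_def remove_preds_def)
  with Cons[of "potential_step G C v P"] show ?case by auto
qed simp

lemma fold_potential_step_blackhole:
  assumes "blackhole G B" "B \<subseteq> P"
  shows "B \<subseteq> fold (potential_step G C) vs P"
  using assms(2)
proof (induct vs arbitrary: P)
  case (Cons v vs)
  have "B \<subseteq> potential_step G C v P"
  proof (cases "v \<in> B")
    case True
    with assms(1) Cons.prems have "\<forall>s. v \<rightarrow> s \<longrightarrow> s \<in> P"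
      by (auto simp: blackhole_def d_out_eq_0_iff)
    with Cons.prems show ?thesis by (auto simp: potential_step_def)
  next
    case False
    with Cons.prems show ?thesis
      using remove_preds_disjoint_blackhole[OF assms(1)] by (simp add: potential_step_def)
  qed
  with Cons.hyps show ?case by simp
qed simp

lemma candidate_step_subset: "fst (candidate_step G i v X) \<subseteq> fst X"
  by (auto simp: candidate_step_def remove_preds_def split: prod.splits)

lemma fold_candidate_step_subset: "fst (fold (candidate_step G i) vs X) \<subseteq> fst X"
proof (induct vs arbitrary: X)
  case (Cons v vs)
  from Cons[of "candidate_step G i v X"] candidate_step_subset[of i v X] show ?case by auto
qed simp

lemma fold_candidate_step_mono: "snd X \<subseteq> snd (fold (candidate_step G i) vs X)"
proof (induct vs arbitrary: X)
  case (Cons v vs)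
  have "snd X \<subseteq> snd (candidate_step G i v X)"
    by (auto simp: candidate_step_def split: prod.splits)
  with Cons[of "candidate_step G i v X"] show ?case by auto
qed simp

text \<open>The list only shrinks, so each processed node stays a vertex of \<open>G\<close> and its
  closure is a blackhole; the guard of the insertion supplies the size \<open>i\<close>.\<close>

lemma fold_candidate_step_sound:
  assumes "fst X \<subseteq> verts G" "B \<in> snd (fold (candidate_step G i) vs X)"
  shows "B \<in> snd X \<or> node_blackhole G i B"
  using assms
proof (induct vs arbitrary: X)
  case (Cons v vs)
  let ?Y = "candidate_step G i v X"
  have "fst ?Y \<subseteq> verts G"
    using candidate_step_subset[of i v X] Cons.prems(1) by blast
  with Cons have "B \<in> snd ?Y \<or> node_blackhole G i B" by simp
  then show ?case
    using Cons.prems(1)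
    by (auto simp: candidate_step_def node_blackhole_def blackhole_closure_of
        split: prod.splits if_splits)
qed simp

text \<open>The invariant is a disjunction because outputting \<open>B\<close> also deletes a node
  of \<open>B\<close> from the list.\<close>

lemma fold_candidate_step_complete:
  assumes "node_blackhole G i B" "B \<subseteq> fst X \<or> B \<in> snd X"
  shows "B \<subseteq> fst (fold (candidate_step G i) vs X) \<or> B \<in> snd (fold (candidate_step G i) vs X)"
  using assms(2)
proof (induct vs arbitrary: X)
  case (Cons v vs)
  obtain C Bh where X: "X = (C, Bh)" by force
  have B: "blackhole G B" "card B = i"
    using assms(1) by (auto simp: node_blackhole_def)
  have fin: "finite B"
    using B by (auto simp: blackhole_def intro: finite_subset)
  have "B \<subseteq> fst (candidate_step G i v X) \<or> B \<in> snd (candidate_step G i v X)"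
  proof (cases "v \<in> B")
    case True
    from B True have sub: "closure_of G v \<subseteq> B" by (simp add: closure_of_subset_blackhole)
    with fin B have "card (closure_of G v) \<le> i" by (auto intro: card_mono)
    \<comment> \<open>With the bound above, a node of \<open>B\<close> triggers a removal only when
      the set inserted is \<open>B\<close> itself.\<close>
    moreover have "closure_of G v = B" if "card (closure_of G v) = i"
      using that sub fin B by (simp add: card_subset_eq)
    ultimately show ?thesis
      using Cons.prems by (auto simp: X candidate_step_def)
  next
    case False
    with Cons.prems show ?thesis
      using remove_preds_disjoint_blackhole[OF B(1)] by (auto simp: X candidate_step_def)
  qed
  with Cons.hyps show ?case by simp
qed simp

end

section \<open>Runs of the algorithm\<close>

context digraph
begin

text \<open>Mapping arcs to heads is injective on the arcs leaving \<open>v\<close>, as there are no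
  parallel arcs. The heads lie in \<open>B\<close> and, without loops, differ from
  \<open>v\<close>.\<close>

lemma out_degree_less_card_blackhole:
  assumes "blackhole G B" "v \<in> B"
  shows "out_degree G v < card B"
proof -
  have fin: "finite B"
    using assms by (auto simp: blackhole_def intro: finite_subset)
  have "inj_on (head G) (out_arcs G v)"
    by (intro inj_onI no_multi_arcs) (auto simp: arc_to_ends_def)
  moreover have "head G ` out_arcs G v \<subseteq> B - {v}"
  proof clarify
    fix e assume "e \<in> out_arcs G v"
    then have "e \<in> arcs G" "tail G e = v" by auto
    moreover from this have "v \<rightarrow> head G e" by (metis in_arcs_imp_in_arcs_ends)
    moreover from calculation have "head G e \<noteq> v" using no_loops by blast
    ultimately show "head G e \<in> B - {v}"
      using assms by (auto simp: blackhole_def d_out_eq_0_iff)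
  qed
  ultimately have "out_degree G v \<le> card (B - {v})"
    unfolding out_degree_def using fin by (intro card_inj_on_le) auto
  also have "\<dots> < card B"
    using fin assms(2) by (rule card_Diff1_less)
  finally show ?thesis .
qed

lemma dc_run_output:
  assumes "dc_run G n Bh C"
  shows "Bh = {B. \<exists>i. 1 \<le> i \<and> i \<le> n \<and> node_blackhole G i B}"
  using assms
proof induct
  case init
  show ?case by auto
next
  case (iter i Bh C P C' Bh')
  let ?P = "{v \<in> verts G. out_degree G v < Suc i}"
  from iter.hyps(3) obtain us where us: "P = fold (potential_step G C) us ?P"
    by (auto simp: potential_loop_def)
  from iter.hyps(4) obtain vs where
    vs: "C' = fst (fold (candidate_step G (Suc i)) vs (P, Bh))"
      "Bh' = snd (fold (candidate_step G (Suc i)) vs (P, Bh))"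
    by (auto simp: candidate_loop_def) (metis fst_conv snd_conv)+
  have P: "P \<subseteq> verts G"
    using fold_potential_step_subset[of C us ?P] us by auto
  with vs(1) have C': "C' \<subseteq> verts G"
    using fold_candidate_step_subset[of "Suc i" vs "(P, Bh)"] by auto
  \<comment> \<open>One iteration adds exactly the blackholes with \<open>Suc i\<close> nodes,
    through (d) or (f).\<close>
  have "B \<in> Bh' \<union> final_blackholes G (Suc i) C' \<longleftrightarrow> B \<in> Bh \<or> node_blackhole G (Suc i) B" for B
  proof
    assume "B \<in> Bh' \<union> final_blackholes G (Suc i) C'"
    then show "B \<in> Bh \<or> node_blackhole G (Suc i) B"
      using fold_candidate_step_sound[of "(P, Bh)" B "Suc i" vs] P vs(2)
        mem_final_blackholes_iff[OF C'] by auto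
  next
    assume "B \<in> Bh \<or> node_blackhole G (Suc i) B"
    then show "B \<in> Bh' \<union> final_blackholes G (Suc i) C'"
    proof
      assume "B \<in> Bh"
      then show ?thesis
        using fold_candidate_step_mono[of "(P, Bh)" "Suc i" vs] vs(2) by auto
    next
      assume B: "node_blackhole G (Suc i) B"
      then have "B \<subseteq> ?P"
        using out_degree_less_card_blackhole[of B]
        by (auto simp: node_blackhole_def) (auto simp: blackhole_def)
      with B us have "B \<subseteq> P"
        by (simp add: node_blackhole_def fold_potential_step_blackhole)
      with B have "B \<subseteq> C' \<or> B \<in> Bh'"
        using fold_candidate_step_complete[of "Suc i" B "(P, Bh)" vs] vs by simp
      with B show ?thesis
        using mem_final_blackholes_iff[OF C'] by auto
    qed
  qed
  then have "Bh' \<union> final_blackholes G (Suc i) C' = {B. B \<in> Bh \<or> node_blackhole G (Suc i) B}"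
    by blast
  then show ?case
    unfolding iter.hyps(2) by (auto simp: le_Suc_eq)
qed

text \<open>This keeps the claim about all outputs from being vacuous: the lists are finite, so each
  loop has an enumeration to fold over.\<close>

lemma dc_run_exists: "\<exists>Bh C. dc_run G n Bh C"
proof (induct n)
  case 0
  show ?case using dc_run.init by blast
next
  case (Suc i)
  then obtain Bh C where run: "dc_run G i Bh C" by blast
  let ?P = "{v \<in> verts G. out_degree G v < Suc i}"
  have "finite ?P" by simp
  then obtain us where us: "set us = ?P" "distinct us"
    using finite_distinct_list by blast
  let ?P' = "fold (potential_step G C) us ?P"
  have "finite ?P'"
    using fold_potential_step_subset[of C us ?P] by (rule finite_subset) simp
  then obtain vs where vs: "set vs = ?P'" "distinct vs"
    using finite_distinct_list by blast
  obtain C' Bh' where "(C', Bh') = fold (candidate_step G (Suc i)) vs (?P', Bh)"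
    by (metis surj_pair)
  with vs have "candidate_loop G (Suc i) ?P' Bh C' Bh'"
    by (auto simp: candidate_loop_def)
  moreover from us have "potential_loop G C ?P ?P'"
    by (auto simp: potential_loop_def)
  ultimately show ?case using dc_run.iter[OF run] by blast
qed

end

theorem mainTheorem3:
  fixes G :: "('a, 'b) pre_digraph" and n :: nat
  assumes "digraph G" and "n \<ge> 1"
  shows "(\<exists>Bh. iBlackhole_DC G n Bh) \<and>
    (\<forall>Bh. iBlackhole_DC G n Bh \<longrightarrow>
       Bh = {B. \<exists>i. 1 \<le> i \<and> i \<le> n \<and> node_blackhole G i B})"
  using digraph.dc_run_exists[OF assms(1)] digraph.dc_run_output[OF assms(1)]
  unfolding iBlackhole_DC_def by blast

end
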